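(* Let $n\ge 1$ and $N=2^n$. Let $E_n$ be the set of unordered triples $\{b_1,b_2,b_3\}$ of distinct words in $\Delta_n$ whose centroids $P(b_1),P(b_2),P(b_3)$ are the vertices of a nondegenerate equilateral triangle. Then $$|E_n|=\frac{N^2(N^2-1)}{12}=\frac{4^n(4^n-1)}{12}.$$
   Context: $\Delta_n=\{i,j,k,e\}^n$ is the set of words $b=b_1b_2\cdots b_n$ of length $n$ in the four symbols $i,j,k,e$. Put $v(i)=(\cos 210^\circ,\sin 210^\circ)$, $v(j)=(\cos 90^\circ,\sin 90^\circ)$, $v(k)=(\cos 330^\circ,\sin 330^\circ)$, $v(e)=(0,0)$ in $\mathbb R^2$. Fix a real $d_1>0$ and put $d_r=d_1/2^{r-1}$. The centroid map $P:\Delta_n\to\mathbb R^2$ is $$P(b)=\sum_{r=1}^n \sigma_r(b)\,d_r\,v(b_r),\qquad \sigma_r(b)=(-1)^{\#\{s<r:\ b_s=e\}}.$$ ($P(b)$ is the centroid of the tile labelled $b$ in the $n$-fold recursive midpoint subdivision of an equilateral triangle.) *)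

theory Defs
  imports "HOL-Analysis.Analysis"
begin

datatype symb = Si | Sj | Sk | Se

definition Delta :: "nat \<Rightarrow> symb list set" where
  "Delta n = {b. length b = n}"

text \<open>Words are indexed from 1, lists from 0.\<close>

definition letter :: "symb list \<Rightarrow> nat \<Rightarrow> symb" where
  "letter b r = b ! (r - 1)"

definition degrees :: "real \<Rightarrow> real" where
  "degrees x = x * pi / 180"

fun dir_vec :: "symb \<Rightarrow> real \<times> real" where
  "dir_vec Si = (cos (degrees 210), sin (degrees 210))"
| "dir_vec Sj = (cos (degrees 90), sin (degrees 90))"
| "dir_vec Sk = (cos (degrees 330), sin (degrees 330))"
| "dir_vec Se = (0, 0)"

definition scale :: "real \<Rightarrow> nat \<Rightarrow> real" where
  "scale d1 r = d1 / 2 ^ (r - 1)"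

text \<open>Each central step (symbol \<open>e\<close>) turns the tile upside down, so it reverses the
  orientation of all later steps.\<close>

definition orient :: "nat \<Rightarrow> symb list \<Rightarrow> real" where
  "orient r b = (- 1) ^ card {s. 1 \<le> s \<and> s < r \<and> letter b s = Se}"

definition centroid :: "real \<Rightarrow> symb list \<Rightarrow> real \<times> real" where
  "centroid d1 b =
     (\<Sum>r = 1..length b. (orient r b * scale d1 r) *\<^sub>R dir_vec (letter b r))"

text \<open>The distance on \<^typ>\<open>real \<times> real\<close> is the Euclidean one.\<close>

definition nondeg_equilateral :: "real \<times> real \<Rightarrow> real \<times> real \<Rightarrow> real \<times> real \<Rightarrow> bool" where
  "nondeg_equilateral p q r \<longleftrightarrow>
     \<not> collinear {p, q, r} \<and> dist p q = dist q r \<and> dist q r = dist r p"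

definition equilateral_triples :: "real \<Rightarrow> nat \<Rightarrow> symb list set set" where
  "equilateral_triples d1 n =
     {{b1, b2, b3} | b1 b2 b3.
        b1 \<in> Delta n \<and> b2 \<in> Delta n \<and> b3 \<in> Delta n \<and>
        b1 \<noteq> b2 \<and> b1 \<noteq> b3 \<and> b2 \<noteq> b3 \<and>
        nondeg_equilateral (centroid d1 b1) (centroid d1 b2) (centroid d1 b3)}"

end

theory Submission
  imports Defs
begin

text \<open>
  Let \<open>N = 2 ^ n\<close>. Up to a scaling, the centroids of the \<open>N\<^sup>2\<close> tiles are points of a triangular
  (Eisenstein) lattice. The vertices of the subdivision belong to the same lattice, and modulo
  a sublattice of index 3 the points inside the big triangle fall into three residue classes: the
  centroids of the upright tiles, those of the inverted tiles, and the vertices. The map from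
  words to centroids is a bijection onto the first two classes (\<open>bij_betw_grid_pos\<close>), because the
  four half-size tiles partition these points.

  The key observation concerns residues. If \<open>p\<close> and \<open>p + z\<close> are two corners of an equilateral
  lattice triangle, the third is obtained from a rotation of \<open>z\<close> by 60 degrees either way
  (\<open>equal_sides_rot60\<close>), and this rotation acts as \<open>-1\<close> on residues. So the residues of the corners
  are \<open>m\<close>, \<open>m + u\<close>, \<open>m - u\<close>: all equal or all different. As the class of the vertices is avoided,
  they are equal, so every equilateral triangle of centroids lies within the upright or within the
  inverted tiles.

  Either class is a full triangular grid, with \<open>N\<close> respectively \<open>N - 1\<close> points along a side. In a
  grid with sides of \<open>k\<close> points, each equilateral triangle is inscribed in a unique upright one.
  It is given by the distances \<open>a\<close>, \<open>b\<close>, \<open>c\<close> of that upright triangle from the three sides of the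
  grid, and the two parts \<open>s + 1\<close>, \<open>t\<close> into which the inscribed corners cut its sides; the five
  natural numbers are subject only to \<open>a + b + c + s + t = k - 2\<close>
  (\<open>inj_on_inscribed\<close>, \<open>inscribed_triangle\<close>, \<open>triangle_inscribed\<close>). Thus the number of triangles
  is \<open>k + 2\<close> choose 4, and the sum of the values for \<open>k = N\<close> and \<open>k = N - 1\<close> is
  \<open>N\<^sup>2 (N\<^sup>2 - 1) / 12\<close>.
\<close>

section \<open>Integer coordinates of the tiles\<close>

text \<open>Coordinates of the centroid with respect to the directions of \<open>i\<close> and \<open>j\<close>, in units of the last
step length. The three directions add up to zero, hence the entry \<open>(-1, -1)\<close> for \<open>k\<close>.\<close>

fun grid_pos :: "symb list \<Rightarrow> int \<times> int" where
  "grid_pos [] = (0, 0)"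
| "grid_pos (Si # b) = (2 ^ length b, 0) + grid_pos b"
| "grid_pos (Sj # b) = (0, 2 ^ length b) + grid_pos b"
| "grid_pos (Sk # b) = (- (2 ^ length b), - (2 ^ length b)) + grid_pos b"
| "grid_pos (Se # b) = - grid_pos b"

text \<open>The numbers \<open>N + 2 * x - y\<close>, \<open>N + 2 * y - x\<close>, \<open>N - x - y\<close> are the barycentric coordinates in the big
triangle with side \<open>N\<close>, scaled to have sum \<open>3 * N\<close>. All three are congruent modulo 3; the residue is 1
for upright tiles, 2 for inverted tiles and 0 for vertices of the subdivision.\<close>

definition sites :: "int \<Rightarrow> (int \<times> int) set" where
  "sites N = {(x, y). - N < 2 * x - y \<and> - N < 2 * y - x \<and> x + y < N \<and> \<not> 3 dvd N - x - y}"

lemma mem_sites: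
  "(x, y) \<in> sites N \<longleftrightarrow> - N < 2 * x - y \<and> - N < 2 * y - x \<and> x + y < N \<and> \<not> 3 dvd N - x - y"
  by (simp add: sites_def)

text \<open>Cutting the triangle into four halves the size. A centroid never lies on a cut line, since there
a barycentric coordinate equals \<open>3 * N\<close>, which is divisible by 3. Recentring at a half-size tile keeps
residues, up to the sign change that comes with turning the central tile upside down.\<close>

lemma sites_double:
  "(x, y) \<in> sites (2 * N) \<longleftrightarrow>
     (x - N, y) \<in> sites N \<or> (x, y - N) \<in> sites N \<or> (x + N, y + N) \<in> sites N \<or> (- x, - y) \<in> sites N"
proof -
  have eqs: "N - (x - N) - y = 2 * N - x - y" "N - x - (y - N) = 2 * N - x - y"
    "N - (x + N) - (y + N) = 2 * N - x - y - 3 * N" "N - - x - - y = 3 * N - (2 * N - x - y)"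
    by simp_all
  have residue: "3 dvd m - 3 * k \<longleftrightarrow> 3 dvd m" "3 dvd 3 * k - m \<longleftrightarrow> 3 dvd m" for m k :: int
    by - presburger+
  have boundary: "2 * x - y \<noteq> N" "2 * y - x \<noteq> N" "x + y \<noteq> - N" if ndvd: "\<not> 3 dvd 2 * N - x - y"
  proof -
    have "2 * N - x - y \<noteq> 3 * k" for k using ndvd by auto
    from this[of "x - y"] this[of "y - x"] this[of N]
    show "2 * x - y \<noteq> N" "2 * y - x \<noteq> N" "x + y \<noteq> - N" by auto
  qed
  show ?thesis
  proof (cases "3 dvd 2 * N - x - y")
    case True
    then show ?thesis unfolding mem_sites eqs residue by simp
  next
    case False
    show ?thesis (is "?L \<longleftrightarrow> ?R")
    proof
      assume L: ?L
      consider "2 * x - y > N" | "2 * y - x > N" | "x + y < - N"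
        | "2 * x - y < N" "2 * y - x < N" "x + y > - N"
        using boundary[OF False] by linarith
      then show ?R
        using L False unfolding mem_sites eqs residue by cases auto
    next
      assume ?R
      then show ?L
        using False unfolding mem_sites eqs residue by auto
    qed
  qed
qed

lemma sites_double_disjoint:
  "(x - N, y) \<in> sites N \<Longrightarrow> (x, y - N) \<notin> sites N"
  "(x - N, y) \<in> sites N \<Longrightarrow> (x + N, y + N) \<notin> sites N"
  "(x - N, y) \<in> sites N \<Longrightarrow> (- x, - y) \<notin> sites N"
  "(x, y - N) \<in> sites N \<Longrightarrow> (x + N, y + N) \<notin> sites N"
  "(x, y - N) \<in> sites N \<Longrightarrow> (- x, - y) \<notin> sites N"
  "(x + N, y + N) \<in> sites N \<Longrightarrow> (- x, - y) \<notin> sites N"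
  unfolding mem_sites by auto

lemma ex_symb: "(\<exists>s. P s) \<longleftrightarrow> P Si \<or> P Sj \<or> P Sk \<or> P Se"
  by (metis symb.exhaust)

lemma grid_pos_Cons_cases:
  fixes b :: "symb list"
  defines "N \<equiv> 2 ^ length b"
  shows "grid_pos (Si # b) = (x, y) \<longleftrightarrow> grid_pos b = (x - N, y)"
    "grid_pos (Sj # b) = (x, y) \<longleftrightarrow> grid_pos b = (x, y - N)"
    "grid_pos (Sk # b) = (x, y) \<longleftrightarrow> grid_pos b = (x + N, y + N)"
    "grid_pos (Se # b) = (x, y) \<longleftrightarrow> grid_pos b = (- x, - y)"
  unfolding N_def by (cases "grid_pos b"; auto)+

text \<open>Induction on the word length: the first letter selects the half-size tile that contains the point,
and the remaining letters locate it there.\<close>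

lemma bij_betw_grid_pos: "bij_betw grid_pos (Delta n) (sites (2 ^ n))"
proof (induction n)
  case 0
  have "x = 0 \<and> y = 0" if "(x, y) \<in> sites 1" for x y
    using that unfolding mem_sites by auto
  then have "sites 1 = {(0, 0)}" by (auto simp: mem_sites)
  then show ?case by (simp add: Delta_def)
next
  case (Suc n)
  from Suc have inj: "inj_on grid_pos (Delta n)" and im: "grid_pos ` Delta n = sites (2 ^ n)"
    unfolding bij_betw_def by auto
  have ex: "\<exists>b. length b = n \<and> grid_pos b = p" if "p \<in> sites (2 ^ n)" for p
    using that unfolding im[symmetric] Delta_def by auto
  have inject: "b = b'" if "length b = n" "length b' = n" "grid_pos b = grid_pos b'" for b b'
    using inj_onD[OF inj that(3)] that(1,2) by (simp add: Delta_def)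
  have mem: "grid_pos b \<in> sites (2 ^ n)" if "length b = n" for b
    using that unfolding im[symmetric] Delta_def by blast
  let ?N = "2 ^ n :: int"
  define pre where "pre s p = (case s of Si \<Rightarrow> (fst p - ?N, snd p) | Sj \<Rightarrow> (fst p, snd p - ?N)
    | Sk \<Rightarrow> (fst p + ?N, snd p + ?N) | Se \<Rightarrow> (- fst p, - snd p))" for s and p :: "int \<times> int"
  have Cons_iff: "grid_pos (s # b) = p \<longleftrightarrow> grid_pos b = pre s p" if "length b = n" for s b p
    using that by (cases p; cases s) (simp_all add: pre_def grid_pos_Cons_cases del: grid_pos.simps)
  have some: "p \<in> sites (2 * ?N) \<longleftrightarrow> (\<exists>s. pre s p \<in> sites ?N)" for p
    by (cases p) (simp add: pre_def sites_double ex_symb)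
  have uniq: "s = s'" if "pre s p \<in> sites ?N" "pre s' p \<in> sites ?N" for s s' p
    using that sites_double_disjoint[where x = "fst p" and y = "snd p" and N = ?N]
    by (cases p; cases s; cases s'; simp add: pre_def)
  show ?case
    unfolding bij_betw_def
  proof
    show "inj_on grid_pos (Delta (Suc n))"
    proof (rule inj_onI)
      fix b b' assume "b \<in> Delta (Suc n)" "b' \<in> Delta (Suc n)" and eq: "grid_pos b = grid_pos b'"
      then obtain s c s' c' where b: "b = s # c" "length c = n" "b' = s' # c'" "length c' = n"
        unfolding Delta_def by (auto simp: length_Suc_conv)
      have *: "grid_pos c = pre s (grid_pos b)" "grid_pos c' = pre s' (grid_pos b)"
        using b eq Cons_iff by metis+
      then have "s = s'" using mem[OF b(2)] mem[OF b(4)] uniq by metis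
      moreover from this have "c = c'" using * inject b by metis
      ultimately show "b = b'" using b by simp
    qed
  next
    have "p \<in> grid_pos ` Delta (Suc n) \<longleftrightarrow> p \<in> sites (2 * ?N)" for p
    proof
      assume "p \<in> grid_pos ` Delta (Suc n)"
      then obtain s c where "length c = n" "grid_pos (s # c) = p"
        unfolding Delta_def by (auto simp: length_Suc_conv)
      then show "p \<in> sites (2 * ?N)" using Cons_iff mem some by metis
    next
      assume "p \<in> sites (2 * ?N)"
      then obtain s where "pre s p \<in> sites ?N" using some by blast
      then obtain c where "length c = n" "grid_pos c = pre s p" using ex by blast
      then have "grid_pos (s # c) = p" "s # c \<in> Delta (Suc n)"
        using Cons_iff by (simp_all add: Delta_def)
      then show "p \<in> grid_pos ` Delta (Suc n)" by blast
    qed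
    then show "grid_pos ` Delta (Suc n) = sites (2 ^ Suc n)" by auto
  qed
qed

section \<open>Centroids in integer coordinates\<close>

lemma dir_vec_exact:
  "dir_vec Si = (- sqrt 3 / 2, - 1 / 2)" "dir_vec Sj = (0, 1)" "dir_vec Sk = (sqrt 3 / 2, - 1 / 2)"
proof -
  have 1: "degrees 210 = pi + pi / 6" "degrees 90 = pi / 2" "degrees 330 = 2 * pi - pi / 6"
    by (simp_all add: degrees_def)
  show "dir_vec Si = (- sqrt 3 / 2, - 1 / 2)" "dir_vec Sj = (0, 1)" "dir_vec Sk = (sqrt 3 / 2, - 1 / 2)"
    by (simp_all only: dir_vec.simps 1 cos_add sin_add cos_diff sin_diff cos_30 sin_30)
       (simp_all add: cos_30 sin_30)
qed

lemma orient_Suc_Cons: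
  assumes "r \<ge> 1"
  shows "orient (Suc r) (s # b) = (if s = Se then - 1 else 1) * orient r b"
proof -
  let ?A = "{t. 1 \<le> t \<and> t < r \<and> letter b t = Se}"
  have letter: "letter (s # b) (Suc t) = letter b t" if "1 \<le> t" for t
    using that by (cases t) (simp_all add: letter_def)
  have one: "letter (s # b) 1 = s" by (simp add: letter_def)
  have "{t. 1 \<le> t \<and> t < Suc r \<and> letter (s # b) t = Se} = (if s = Se then {1} else {}) \<union> Suc ` ?A"
    (is "?L = ?R")
  proof (intro set_eqI)
    fix t show "t \<in> ?L \<longleftrightarrow> t \<in> ?R"
    proof (cases "t \<le> 1")
      case True
      then have "t = 0 \<or> t = 1" by linarith
      then show ?thesis using assms one by (auto simp: image_iff)
    next
      case False
      then obtain u where "t = Suc u" "1 \<le> u" by (cases t) auto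
      then show ?thesis using letter by (auto simp: image_iff)
    qed
  qed
  moreover have "card ?R = (if s = Se then 1 else 0) + card ?A"
    by (subst card_Un_disjoint) (auto simp: card_image)
  ultimately show ?thesis unfolding orient_def by simp
qed

lemma centroid_Cons:
  "centroid d (s # b) = d *\<^sub>R dir_vec s + (if s = Se then - 1 else 1) *\<^sub>R centroid (d / 2) b"
proof -
  let ?f = "\<lambda>r. (orient r (s # b) * scale d r) *\<^sub>R dir_vec (letter (s # b) r)"
  have 1: "?f 1 = d *\<^sub>R dir_vec s"
  proof -
    have "{t. 1 \<le> t \<and> t < 1 \<and> letter (s # b) t = Se} = {}" by auto
    then have "orient 1 (s # b) = 1" unfolding orient_def by (simp only: card.empty power_0)
    then show ?thesis by (simp add: scale_def letter_def)
  qed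
  have 2: "?f (Suc r) = (if s = Se then - 1 else 1) *\<^sub>R
      ((orient r b * scale (d / 2) r) *\<^sub>R dir_vec (letter b r))" if "r \<in> {1..length b}" for r
  proof -
    from that obtain q where "r = Suc q" by (cases r) auto
    then show ?thesis by (subst orient_Suc_Cons) (simp_all add: scale_def letter_def)
  qed
  have "centroid d (s # b) = ?f 1 + (\<Sum>r = Suc 1..Suc (length b). ?f r)"
    unfolding centroid_def by (subst sum.atLeast_Suc_atMost) simp_all
  also have "(\<Sum>r = Suc 1..Suc (length b). ?f r) = (\<Sum>r = 1..length b. ?f (Suc r))"
    by (rule sum.shift_bounds_cl_Suc_ivl)
  also have "\<dots> = (if s = Se then - 1 else 1) *\<^sub>R centroid (d / 2) b"
    unfolding centroid_def scaleR_sum_right by (intro sum.cong refl 2)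
  finally show ?thesis using 1 by simp
qed

definition plane :: "int \<times> int \<Rightarrow> real \<times> real" where
  "plane p = real_of_int (fst p) *\<^sub>R dir_vec Si + real_of_int (snd p) *\<^sub>R dir_vec Sj"

lemma plane_simp: "plane (x, y) = (- (sqrt 3 / 2) * x, y - x / 2)"
  by (simp add: plane_def dir_vec_exact del: dir_vec.simps)

lemma centroid_eq_plane:
  "centroid d b = (2 * d / 2 ^ length b) *\<^sub>R plane (grid_pos b)"
proof (induction b arbitrary: d)
  case Nil
  then show ?case by (simp add: centroid_def plane_def zero_prod_def)
next
  case (Cons s b)
  obtain x y where p: "grid_pos b = (x, y)" by force
  show ?case
    unfolding centroid_Cons Cons
    by (cases s) (simp_all add: p plane_simp dir_vec_exact field_simps zero_prod_def del: dir_vec.simps(1-3))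
qed

text \<open>The squared Euclidean length of a lattice vector: the two basis directions enclose 120 degrees.\<close>

fun eis_norm :: "int \<times> int \<Rightarrow> int" where
  "eis_norm (x, y) = x\<^sup>2 - x * y + y\<^sup>2"

lemma norm_plane: "(norm (plane p))\<^sup>2 = eis_norm p"
proof -
  have "(norm u)\<^sup>2 = (fst u)\<^sup>2 + (snd u)\<^sup>2" for u :: "real \<times> real"
    by (cases u) (simp add: norm_Pair)
  then show ?thesis
    by (cases p) (simp add: plane_simp power2_eq_square algebra_simps)
qed

lemma plane_diff: "plane (p - q) = plane p - plane q"
  by (simp add: plane_def algebra_simps)

definition equidistant :: "int \<times> int \<Rightarrow> int \<times> int \<Rightarrow> int \<times> int \<Rightarrow> bool" where
  "equidistant p q r \<longleftrightarrow>
     eis_norm (p - q) = eis_norm (q - r) \<and> eis_norm (q - r) = eis_norm (r - p)"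

text \<open>If three collinear points were equidistant, the one in between would make the common distance
equal to its double, hence zero.\<close>

lemma nondeg_equilateral_iff:
  "nondeg_equilateral p q r \<longleftrightarrow> p \<noteq> q \<and> dist p q = dist q r \<and> dist q r = dist r p"
proof
  assume R: "p \<noteq> q \<and> dist p q = dist q r \<and> dist q r = dist r p"
  have "\<not> collinear {p, q, r}"
  proof
    assume "collinear {p, q, r}"
    then consider "between (q, r) p" | "between (r, p) q" | "between (p, q) r"
      using collinear_between_cases by blast
    then show False
      using R by cases (auto simp: between dist_commute)
  qed
  then show "nondeg_equilateral p q r" using R by (simp add: nondeg_equilateral_def)
qed (auto simp: nondeg_equilateral_def)

lemma dist_centroid_eq_iff:
  assumes "d > 0" "length b1 = n" "length b2 = n" "length b3 = n" "length b4 = n"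
  shows "dist (centroid d b1) (centroid d b2) = dist (centroid d b3) (centroid d b4) \<longleftrightarrow>
    eis_norm (grid_pos b1 - grid_pos b2) = eis_norm (grid_pos b3 - grid_pos b4)"
proof -
  have D: "dist (centroid d b) (centroid d b') =
      (2 * d / 2 ^ n) * norm (plane (grid_pos b - grid_pos b'))"
    if "length b = n" "length b' = n" for b b'
    using that \<open>d > 0\<close>
    by (simp add: centroid_eq_plane dist_norm plane_diff flip: scaleR_diff_right)
  have "norm (plane p) = norm (plane q) \<longleftrightarrow> eis_norm p = eis_norm q" for p q
    by (metis norm_plane of_int_eq_iff norm_ge_zero power2_eq_imp_eq)
  then show ?thesis using assms by (simp add: D)
qed

lemma eis_norm_eq_0_iff [simp]: "eis_norm p = 0 \<longleftrightarrow> p = 0"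
proof (cases p)
  case (Pair x y)
  have "4 * eis_norm (x, y) = (2 * x - y)\<^sup>2 + 3 * y\<^sup>2"
    by (simp add: power2_eq_square algebra_simps)
  moreover have "0 \<le> (2 * x - y)\<^sup>2" "0 \<le> y\<^sup>2" by simp_all
  ultimately have "eis_norm (x, y) = 0 \<Longrightarrow> (2 * x - y)\<^sup>2 = 0 \<and> y\<^sup>2 = 0" by linarith
  then show ?thesis using Pair by (auto simp: zero_prod_def)
qed

lemma nondeg_equilateral_centroid_iff:
  assumes "d > 0" "b1 \<in> Delta n" "b2 \<in> Delta n" "b3 \<in> Delta n" "b1 \<noteq> b2"
  shows "nondeg_equilateral (centroid d b1) (centroid d b2) (centroid d b3) \<longleftrightarrow>
    equidistant (grid_pos b1) (grid_pos b2) (grid_pos b3)"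
proof -
  have l: "length b1 = n" "length b2 = n" "length b3 = n" using assms by (auto simp: Delta_def)
  have "grid_pos b1 \<noteq> grid_pos b2"
    using bij_betw_grid_pos[of n] assms unfolding bij_betw_def inj_on_def by blast
  then have "centroid d b1 \<noteq> centroid d b2"
    using dist_centroid_eq_iff[OF assms(1) l(1,2) l(1,1)]
    by (metis diff_self dist_self eis_norm_eq_0_iff right_minus_eq)
  then show ?thesis
    unfolding nondeg_equilateral_iff equidistant_def
    using dist_centroid_eq_iff[OF assms(1)] l by blast
qed

definition triangles :: "(int \<times> int) set \<Rightarrow> (int \<times> int) set set" where
  "triangles S = {{p, q, r} | p q r. p \<in> S \<and> q \<in> S \<and> r \<in> S \<and>
     p \<noteq> q \<and> p \<noteq> r \<and> q \<noteq> r \<and> equidistant p q r}"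

lemma card_equilateral_triples:
  assumes "d > 0"
  shows "card (equilateral_triples d n) = card (triangles (sites (2 ^ n)))"
proof -
  have inj: "inj_on grid_pos (Delta n)" and im: "grid_pos ` Delta n = sites (2 ^ n)"
    using bij_betw_grid_pos unfolding bij_betw_def by auto
  have "equilateral_triples d n \<subseteq> Pow (Delta n)"
    unfolding equilateral_triples_def by auto
  then have "inj_on ((`) grid_pos) (equilateral_triples d n)"
    using inj inj_on_image_Pow inj_on_subset by blast
  moreover have "(`) grid_pos ` equilateral_triples d n = triangles (sites (2 ^ n))"
  proof (intro equalityI subsetI)
    fix T assume "T \<in> (`) grid_pos ` equilateral_triples d n"
    then obtain b1 b2 b3 where
      b: "b1 \<in> Delta n" "b2 \<in> Delta n" "b3 \<in> Delta n" "b1 \<noteq> b2" "b1 \<noteq> b3" "b2 \<noteq> b3"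
      and e: "nondeg_equilateral (centroid d b1) (centroid d b2) (centroid d b3)"
      and T: "T = {grid_pos b1, grid_pos b2, grid_pos b3}"
      unfolding equilateral_triples_def by auto
    have "equidistant (grid_pos b1) (grid_pos b2) (grid_pos b3)"
      using nondeg_equilateral_centroid_iff assms b e by blast
    then show "T \<in> triangles (sites (2 ^ n))"
      unfolding triangles_def T using b inj im inj_on_eq_iff[OF inj] by blast
  next
    fix T assume "T \<in> triangles (sites (2 ^ n))"
    then obtain p q r where "p \<in> grid_pos ` Delta n" "q \<in> grid_pos ` Delta n" "r \<in> grid_pos ` Delta n"
      and ne: "p \<noteq> q" "p \<noteq> r" "q \<noteq> r" and e: "equidistant p q r" and T: "T = {p, q, r}"
      unfolding triangles_def im by auto
    then obtain b1 b2 b3 where b: "b1 \<in> Delta n" "b2 \<in> Delta n" "b3 \<in> Delta n"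
      and g: "p = grid_pos b1" "q = grid_pos b2" "r = grid_pos b3" by auto
    have "{b1, b2, b3} \<in> equilateral_triples d n"
      unfolding equilateral_triples_def mem_Collect_eq
      using b ne e nondeg_equilateral_centroid_iff[OF assms] unfolding g by blast
    moreover have "T = grid_pos ` {b1, b2, b3}" using T g by simp
    ultimately show "T \<in> (`) grid_pos ` equilateral_triples d n" by blast
  qed
  ultimately show ?thesis using card_image by metis
qed

section \<open>Counting lattice triangles\<close>

text \<open>The directions of \<open>i\<close> and \<open>j\<close> are at 210 and 90 degrees. A counterclockwise turn by 60 degrees
moves the first opposite to \<open>j\<close> and the second opposite to \<open>k\<close>.\<close>

fun rot60 :: "int \<times> int \<Rightarrow> int \<times> int" where
  "rot60 (x, y) = (y, y - x)"

text \<open>In complex notation \<open>(w - \<zeta> z) (w - \<zeta>' z) = w\<^sup>2 - w z + z\<^sup>2\<close> for the two primitive sixth roots of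
unity, and this vanishes when \<open>z\<close>, \<open>w\<close>, \<open>z - w\<close> have equal length. In integers, the number \<open>B\<close>,
twice the inner product of \<open>z\<close> and \<open>w\<close>, equals their common norm \<open>Q\<close>, so the Lagrange identity forces the
determinant \<open>D\<close> to be \<open>Q\<close> or \<open>-Q\<close>; the sign decides which of the two rotations occurs.\<close>

lemma equal_sides_rot60:
  assumes "eis_norm z = eis_norm w" "eis_norm (z - w) = eis_norm z"
  shows "w = rot60 z \<or> z = rot60 w"
proof -
  obtain a b c d where z: "z = (a, b)" and w: "w = (c, d)" by (cases z; cases w) auto
  define Q where "Q = a\<^sup>2 - a * b + b\<^sup>2"
  define B where "B = 2 * a * c - a * d - b * c + 2 * b * d"
  define D where "D = a * d - b * c"
  have Qw: "c\<^sup>2 - c * d + d\<^sup>2 = Q" using assms(1) by (simp add: z w Q_def)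
  have "eis_norm (z - w) = Q + (c\<^sup>2 - c * d + d\<^sup>2) - B"
    by (simp add: z w Q_def B_def power2_eq_square algebra_simps)
  then have B: "B = Q" using assms(2) Qw by (simp add: z Q_def)
  have "4 * (Q * (c\<^sup>2 - c * d + d\<^sup>2)) = B\<^sup>2 + 3 * D\<^sup>2"
    by (simp add: Q_def B_def D_def power2_eq_square algebra_simps)
  then have "D\<^sup>2 = Q\<^sup>2" using B Qw by (simp add: power2_eq_square)
  then have D: "D = - Q \<or> D = Q" using power2_eq_iff by blast
  have "2 * eis_norm (w - rot60 z) = 2 * (c\<^sup>2 - c * d + d\<^sup>2) + 2 * Q - B + 3 * D"
    by (simp add: z w Q_def B_def D_def power2_eq_square algebra_simps)
  moreover have "2 * eis_norm (z - rot60 w) = 2 * (c\<^sup>2 - c * d + d\<^sup>2) + 2 * Q - B - 3 * D"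
    by (simp add: z w Q_def B_def D_def power2_eq_square algebra_simps)
  ultimately have "2 * eis_norm (w - rot60 z) = 3 * (Q + D)" "2 * eis_norm (z - rot60 w) = 3 * (Q - D)"
    using B Qw by auto
  then show ?thesis using D by auto
qed

text \<open>The upright triangle at distances \<open>a\<close>, \<open>b\<close>, \<open>c\<close> from the sides of the grid has side \<open>k + t\<close>;
in barycentric grid coordinates relative to \<open>(a, b, c)\<close> the inscribed corners are
\<open>(k, t, 0)\<close>, \<open>(0, k, t)\<close>, \<open>(t, 0, k)\<close>. Taking \<open>k = s + 1\<close> positive while \<open>t\<close> may vanish makes the
description unique: otherwise the upright triangle itself would occur twice.\<close>

fun inscribed :: "nat list \<Rightarrow> (int \<times> int) set" where
  "inscribed [a, b, c, s, t] =
     (let x = int a - int c; y = int b - int c; k = int s + 1; t = int t in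
       {(x + k, y + t), (x - t, y + k - t), (x + t - k, y - k)})"
| "inscribed _ = {}"

text \<open>The two alternatives belong to the grids of the upright tiles, \<open>N\<close> points along a side, and of the inverted
tiles, \<open>N - 1\<close> points along a side.\<close>

definition frames :: "nat \<Rightarrow> nat list set" where
  "frames N = {l. length l = 5 \<and> (sum_list l + 2 = N \<or> sum_list l + 3 = N)}"

lemma framesE:
  assumes "l \<in> frames N"
  obtains a b c s t where "l = [a, b, c, s, t]"
    "a + b + c + s + t + 2 = N \<or> a + b + c + s + t + 3 = N"
  using assms unfolding frames_def
  by (auto simp: length_Suc_conv numeral_eq_Suc algebra_simps)

lemma inscribed_triangle:
  assumes "l \<in> frames N"
  shows "inscribed l \<in> triangles (sites (int N))"
proof -
  from assms obtain a b c s t where l: "l = [a, b, c, s, t]"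
    and sum: "a + b + c + s + t + 2 = N \<or> a + b + c + s + t + 3 = N" by (rule framesE)
  define e where "e = int N - (int a + b + c + s + t + 1)"
  have e: "e = 1 \<or> e = 2" using sum unfolding e_def by linarith
  have N: "int N = int a + b + c + s + t + 1 + e" by (simp add: e_def)
  have ndvd: "\<not> 3 dvd 3 * w + e" for w :: int using e by presburger
  define x y k u where d: "x = int a - int c" "y = int b - int c" "k = int s + 1" "u = int t"
  let ?p = "(x + k, y + u)" and ?q = "(x - u, y + k - u)" and ?r = "(x + u - k, y - k)"
  have "inscribed l = {?p, ?q, ?r}" by (simp add: l d Let_def)
  moreover have "?p \<in> sites (int N)"
    using e ndvd[of "int c"] unfolding N d mem_sites by (auto simp: algebra_simps)
  moreover have "?q \<in> sites (int N)"
    using e ndvd[of "int c + int t"] unfolding N d mem_sites by (auto simp: algebra_simps)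
  moreover have "?r \<in> sites (int N)"
    using e ndvd[of "int c + int s + 1"] unfolding N d mem_sites by (auto simp: algebra_simps)
  moreover have "?p \<noteq> ?q" "?p \<noteq> ?r" "?q \<noteq> ?r" unfolding d by auto
  moreover have "equidistant ?p ?q ?r"
    by (simp add: equidistant_def power2_eq_square algebra_simps)
  ultimately show ?thesis unfolding triangles_def by blast
qed

text \<open>Each bound is the smallest value of a barycentric coordinate on the three corners, shifted by a
constant. These minima locate the circumscribed upright triangle.\<close>

lemma inscribed_bounds:
  assumes "(x, y) \<in> inscribed [a, b, c, s, t]"
  shows "2 * x - y \<ge> 2 * int a - b - c - s - t - 1"
    "2 * y - x \<ge> 2 * int b - a - c - s - t - 1"
    "- x - y \<ge> 2 * int c - a - b - s - t - 1"
  using assms by (auto simp: Let_def)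

text \<open>Equal triangles have equal coordinate minima. These determine the side \<open>s + 1 + t\<close> of the upright
triangle and its position up to adding a constant to \<open>a\<close>, \<open>b\<close>, \<open>c\<close> simultaneously; that
constant is zero because the two permitted sums differ by less than 3. A corner then separates
\<open>s\<close> from \<open>t\<close>.\<close>

lemma inj_on_inscribed: "inj_on inscribed (frames N)"
proof (rule inj_onI)
  fix l l' assume l: "l \<in> frames N" and l': "l' \<in> frames N" and eq: "inscribed l = inscribed l'"
  from l obtain a b c s t where L: "l = [a, b, c, s, t]"
    and N: "a + b + c + s + t + 2 = N \<or> a + b + c + s + t + 3 = N" by (rule framesE)
  from l' obtain a' b' c' s' t' where L': "l' = [a', b', c', s', t']"
    and N': "a' + b' + c' + s' + t' + 2 = N \<or> a' + b' + c' + s' + t' + 3 = N" by (rule framesE)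
  have low: "2 * int a - b - c - s - t \<ge> 2 * int a' - b' - c' - s' - t'
    \<and> 2 * int b - a - c - s - t \<ge> 2 * int b' - a' - c' - s' - t'
    \<and> 2 * int c - a - b - s - t \<ge> 2 * int c' - a' - b' - s' - t'"
    if "inscribed [a, b, c, s, t] = inscribed [a', b', c', s', t']" for a b c s t a' b' c' s' t'
  proof -
    have v: "(int a - c + s + 1, int b - c + t) \<in> inscribed [a', b', c', s', t']"
      "(int a - c - t, int b - c + s + 1 - t) \<in> inscribed [a', b', c', s', t']"
      "(int a - c + t - s - 1, int b - c - s - 1) \<in> inscribed [a', b', c', s', t']"
      unfolding that[symmetric] by (simp_all add: Let_def)
    show ?thesis
      using inscribed_bounds[OF v(1)] inscribed_bounds[OF v(2)] inscribed_bounds[OF v(3)]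
      by auto
  qed
  have e: "2 * int a - b - c - s - t = 2 * int a' - b' - c' - s' - t'"
    "2 * int b - a - c - s - t = 2 * int b' - a' - c' - s' - t'"
    "2 * int c - a - b - s - t = 2 * int c' - a' - b' - s' - t'"
    using low[OF eq[unfolded L L']] low[OF eq[unfolded L L', symmetric]] by - linarith+
  then have st: "s + t = s' + t'" and ab: "int a - a' = int b - b'" and ac: "int a - a' = int c - c'"
    by - linarith+
  have "int a - a' \<le> 0 \<and> int a - a' \<ge> 0" using N N' st ab ac by linarith
  then have "a = a'" by simp
  then have abc: "a = a'" "b = b'" "c = c'" using ab ac by auto
  have "(int a - c + s + 1, int b - c + t) \<in> inscribed [a, b, c, s', t']"
    using eq[unfolded L L', symmetric] abc by (simp add: Let_def)
  then have "s = s' \<and> t = t'" using st by (auto simp: Let_def)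
  then show "l = l'" using L L' abc by simp
qed

text \<open>The residue argument gives three corners in one class, with coordinates as in \<open>inscribed\<close>. The corners
of a triangle can be rotated cyclically, and the list of parameters is read off from the rotation in which the
first barycentric coordinate drops from the first corner to the second while the third one does
not drop. The third coordinate changes there by as much as the first does along the next side.\<close>

lemma triangle_inscribed:
  assumes "T \<in> triangles (sites (int N))"
  shows "T \<in> inscribed ` frames N"
proof -
  have frame: "{p, q, r} \<in> inscribed ` frames N"
    if S: "p \<in> sites (int N)" "q \<in> sites (int N)" "r \<in> sites (int N)"
      and rot: "q - p = rot60 (r - p)"
      and neg: "2 * fst (q - p) < snd (q - p)" and nn: "fst (q - p) + snd (q - p) \<le> 0" for p q r
  proof -
    obtain A B where p: "p = (A, B)" by force
    obtain x y where rp: "r - p = (x, y)" by force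
    then have qp: "q - p = (y, y - x)" using rot by simp
    have q: "q = (A + y, B + (y - x))" using qp unfolding p by (cases q) simp
    have r: "r = (A + x, B + y)" using rp unfolding p by (cases r) simp
    have S': "(A, B) \<in> sites (int N)" "(A + y, B + (y - x)) \<in> sites (int N)"
      "(A + x, B + y) \<in> sites (int N)"
      using S by (simp_all add: p q r)
    define m u where "m = int N - A - B" and "u = x + y"
    (* Modulo 3 the corners have residues m, m + u and m - u, none of which is 0. *)
    have "\<not> 3 dvd m" "\<not> 3 dvd m + u - 3 * y" "\<not> 3 dvd m - u"
      using S' unfolding mem_sites m_def u_def by (simp_all add: algebra_simps)
    then have "3 dvd u" by presburger
    then obtain h where "x + y = 3 * h" unfolding u_def by (elim dvdE)
    then have h: "x = 3 * h - y" by simp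
    define Z e where "Z = m div 3" and "e = m mod 3"
    then have Z: "m = 3 * Z + e" by simp
    have e: "e = 1 \<or> e = 2" using \<open>\<not> 3 dvd m\<close> unfolding e_def by presburger
    define X Y where "X = Z + A + h" and "Y = Z + B + (y - h)"
    then have eqs: "A = X - Z - h" "B = Y - Z + (h - y)" by simp_all
    have N: "int N = 3 * Z + e + A + B" using Z by (simp add: m_def)
    have pos: "0 \<le> X" "0 \<le> Y" "0 \<le> Z"
      using S' e unfolding mem_sites N h X_def Y_def by auto
    have k: "0 \<le> - h - 1" "0 \<le> h - y" using neg nn unfolding qp h by simp_all
    have "X + Y + Z - y + 1 = int N \<or> X + Y + Z - y + 2 = int N"
      using e unfolding N X_def Y_def by auto
    then have "[nat X, nat Y, nat Z, nat (- h - 1), nat (h - y)] \<in> frames N" (is "?l \<in> _")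
      using pos k unfolding frames_def by (simp add: nat_eq_iff2) arith
    moreover have "inscribed ?l = {p, q, r}"
      using pos k unfolding p q r eqs h by (simp add: Let_def algebra_simps)
    ultimately show ?thesis by (metis image_eqI)
  qed
  have clockwise: "{p, q, r} \<in> inscribed ` frames N"
    if S: "p \<in> sites (int N)" "q \<in> sites (int N)" "r \<in> sites (int N)"
      and ne: "p \<noteq> q" and rot: "q - p = rot60 (r - p)" for p q r
  proof -
    obtain p1 p2 z1 z2 where p: "p = (p1, p2)" and z: "q - p = (z1, z2)" by force
    have q: "q = (p1 + z1, p2 + z2)" using z unfolding p by (cases q) simp
    have r: "r = (p1 + z1 - z2, p2 + z1)" using rot unfolding q p by (cases r) simp
    have z': "r - q = (- z2, z1 - z2)" "p - r = (z2 - z1, - z1)"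
      by (simp_all add: p q r)
    have rots: "r - q = rot60 (p - q)" "p - r = rot60 (q - r)"
      by (simp_all add: p q r)
    (* Along the three sides the first barycentric coordinate changes by 2 * z1 - z2, - z1 - z2 and
       2 * z2 - z1. These changes have sum 0 and do not all vanish, so in cyclic order some negative
       one is followed by a nonnegative one. *)
    have "z1 \<noteq> 0 \<or> z2 \<noteq> 0" using ne by (simp add: p q)
    then consider "2 * z1 < z2" "z1 + z2 \<le> 0" | "z1 + z2 > 0" "2 * z2 - z1 \<ge> 0"
      | "2 * z2 < z1" "2 * z1 - z2 \<ge> 0" by linarith
    then show ?thesis
    proof cases
      case 1
      then show ?thesis using frame[OF S rot] unfolding z by simp
    next
      case 2
      then have "{q, r, p} \<in> inscribed ` frames N"
        using frame[OF S(2,3,1) rots(1)] unfolding z' by simp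
      moreover have "{q, r, p} = {p, q, r}" by auto
      ultimately show ?thesis by simp
    next
      case 3
      then have "{r, p, q} \<in> inscribed ` frames N"
        using frame[OF S(3,1,2) rots(2)] unfolding z' by simp
      moreover have "{r, p, q} = {p, q, r}" by auto
      ultimately show ?thesis by simp
    qed
  qed
  obtain p q r where S: "p \<in> sites (int N)" "q \<in> sites (int N)" "r \<in> sites (int N)"
    and ne: "p \<noteq> q" "p \<noteq> r" and e: "equidistant p q r" and T: "T = {p, q, r}"
    using assms unfolding triangles_def by auto
  have "r - p = rot60 (q - p) \<or> q - p = rot60 (r - p)"
  proof (rule equal_sides_rot60)
    have minus: "eis_norm (v - u) = eis_norm (u - v)" for u v
      by (cases u; cases v) (simp add: power2_eq_square algebra_simps)
    show "eis_norm (q - p) = eis_norm (r - p)"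
      using e unfolding equidistant_def minus[of q p] by simp
    show "eis_norm (q - p - (r - p)) = eis_norm (q - p)"
      using e unfolding equidistant_def minus[of q p] by simp
  qed
  then show ?thesis
  proof
    assume "r - p = rot60 (q - p)"
    then have "{p, r, q} \<in> inscribed ` frames N" using clockwise S ne by metis
    moreover have "{p, r, q} = T" unfolding T by auto
    ultimately show ?thesis by simp
  next
    assume "q - p = rot60 (r - p)"
    then show ?thesis unfolding T using clockwise S ne by metis
  qed
qed

text \<open>Lists of length 5 with a prescribed sum are counted by stars and bars. For sums that would be
negative the set is empty and the binomial coefficient vanishes as well.\<close>

lemma card_frames: "card (frames N) = ((N + 2) choose 4) + ((N + 1) choose 4)"
proof -
  have "card {l. length l = 5 \<and> sum_list l + k = N} = (N + 4 - k) choose 4"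
    if "k \<ge> 1" for k
  proof (cases "k \<le> N")
    case True
    then have "{l. length l = 5 \<and> sum_list l + k = N} = {l. length l = 5 \<and> sum_list l = N - k}"
      by auto
    moreover have "(4 + N - k) choose (N - k) = (N + 4 - k) choose 4"
      using True by (subst binomial_symmetric) (simp_all add: add.commute)
    ultimately show ?thesis using True by (simp add: card_length_sum_list)
  next
    case False
    then have "{l. length l = 5 \<and> sum_list l + k = N} = {}" by auto
    then show ?thesis using False that by (simp only: card.empty) (simp add: binomial_eq_0)
  qed
  from this[of 2] this[of 3]
  have c: "card {l. length l = 5 \<and> sum_list l + 2 = N} = (N + 2) choose 4"
    "card {l. length l = 5 \<and> sum_list l + 3 = N} = (N + 1) choose 4" by simp_all
  have fin: "finite {l :: nat list. length l = 5 \<and> sum_list l + k = N}" for k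
  proof (rule finite_subset)
    show "{l. length l = 5 \<and> sum_list l + k = N} \<subseteq> {l. set l \<subseteq> {..N} \<and> length l = 5}"
      using member_le_sum_list by fastforce
  qed (rule finite_lists_length_eq, simp)
  have "frames N = {l. length l = 5 \<and> sum_list l + 2 = N} \<union> {l. length l = 5 \<and> sum_list l + 3 = N}"
    unfolding frames_def by auto
  then have "card (frames N) = card {l :: nat list. length l = 5 \<and> sum_list l + 2 = N}
      + card {l :: nat list. length l = 5 \<and> sum_list l + 3 = N}"
    by (simp only:) (rule card_Un_disjoint[OF fin fin], auto)
  then show ?thesis using c by simp
qed

lemma sum_choose_4: "12 * (((N + 2) choose 4) + ((N + 1) choose 4)) + N\<^sup>2 = N\<^sup>2 * N\<^sup>2"
proof -
  have choose4: "real (k choose 4) = real k * (real k - 1) * (real k - 2) * (real k - 3) / 24" for k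
    by (simp add: binomial_gbinomial gbinomial_prod_rev eval_nat_numeral atLeast0_lessThan_Suc)
  have "real (12 * (((N + 2) choose 4) + ((N + 1) choose 4)) + N\<^sup>2) = real (N\<^sup>2 * N\<^sup>2)"
    by (simp add: choose4 power2_eq_square field_simps)
  then show ?thesis by (simp only: of_nat_eq_iff)
qed

lemma card_triangles_sites: "card (triangles (sites (int N))) = card (frames N)"
proof -
  have "inscribed ` frames N = triangles (sites (int N))"
    using inscribed_triangle triangle_inscribed by blast
  then show ?thesis using card_image[OF inj_on_inscribed] by metis
qed

theorem corollary4p4:
  fixes d1 :: real and n N :: nat
  assumes "d1 > 0" and "n \<ge> 1" and "N = 2 ^ n"
  shows "real (card (equilateral_triples d1 n)) = (real N)\<^sup>2 * ((real N)\<^sup>2 - 1) / 12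
       \<and> (real N)\<^sup>2 * ((real N)\<^sup>2 - 1) / 12 = 4 ^ n * (4 ^ n - 1) / 12"
proof
  have "12 * card (equilateral_triples d1 n) + N\<^sup>2 = N\<^sup>2 * N\<^sup>2"
    using sum_choose_4[of N] unfolding card_frames[symmetric] card_triangles_sites[symmetric]
      card_equilateral_triples[OF assms(1)] by (simp add: assms(3))
  then have "12 * real (card (equilateral_triples d1 n)) + (real N)\<^sup>2 = (real N)\<^sup>2 * (real N)\<^sup>2"
    by (metis of_nat_add of_nat_mult of_nat_numeral of_nat_power)
  then show "real (card (equilateral_triples d1 n)) = (real N)\<^sup>2 * ((real N)\<^sup>2 - 1) / 12"
    by (simp add: algebra_simps)
  have "(real N)\<^sup>2 = 4 ^ n"
    by (simp add: assms(3) power2_eq_square flip: power_mult_distrib)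
  then show "(real N)\<^sup>2 * ((real N)\<^sup>2 - 1) / 12 = 4 ^ n * (4 ^ n - 1) / 12" by simp
qed

end
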